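(* Let $\phi:S^n\to\mathbb{R}$ be bounded and continuous. Then $$\sup\left\{\int\phi\,d\nu-H(\nu\mid\mu):\nu\in\bigcap_{j=1}^n\mathcal{R}_j\right\}=\inf_{\mathbf{m}\in\Delta}\operatorname{Parisi}(\mathbf{m},\phi).$$ (The left-hand side is denoted $J^*(\phi)$.)
   Context: Let $S$ be a Polish space with its Borel $\sigma$-field, let $n\in\mathbb{N}$ be fixed, and let $\mu_1,\dots,\mu_n$ be Borel probability measures on $S$; put $\mu=\mu_1\otimes\cdots\otimes\mu_n$. Let $\gamma_1,\dots,\gamma_n>0$ with $\sum_{k=1}^n\gamma_k=1$, and $\Gamma_j=\sum_{k=1}^j\gamma_k$. $\mathcal{M}_1^+(S^n)$ is the set of Borel probability measures on $S^n$. $H(\nu\mid\mu)$ is the relative entropy: $\int\log\frac{d\nu}{d\mu}\,d\nu$ if $\nu\ll\mu$, and $\infty$ otherwise. For $\nu\in\mathcal{M}_1^+(S^n)$, $\nu^{(j)}$ denotes its marginal on the first $j$ coordinates (so $\mu^{(j)}=\mu_1\otimes\cdots\otimes\mu_j$), and $$\mathcal{R}_j=\left\{\nu\in\mathcal{M}_1^+(S^n): H(\nu^{(j)}\mid\mu^{(j)})\le\Gamma_j\log2\right\}.$$ $\Delta$ is the set of sequences $\mathbf{m}=(m_1,\dots,m_n)$ with $0<m_1\le m_2\le\cdots\le m_n\le1$. For $\mathbf{m}\in\Delta$ and bounded measurable $\phi:S^n\to\mathbb{R}$ define recursively $\phi_j:S^j\to\mathbb{R}$, $0\le j\le n$, by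 $\phi_n=\phi$ and $$\phi_{j-1}(x_1,\dots,x_{j-1})=\frac1{m_j}\log\int\exp\left[m_j\phi_j(x_1,\dots,x_{j-1},x_j)\right]\mu_j(dx_j),\qquad 1\le j\le n.$$ $\phi_0$ is a real number, denoted $\phi_0(\mathbf{m})$. Put $$\operatorname{Parisi}(\mathbf{m},\phi)=\sum_{i=1}^n\frac{\gamma_i\log2}{m_i}+\phi_0(\mathbf{m})-\log2.$$ *)

theory Defs
  imports "HOL-Probability.Probability"
begin

text \<open>
  Points of \<open>S^j\<close> are the extensional functions in \<open>{1..j} \<rightarrow>\<^sub>E UNIV\<close>, so that \<open>S^0\<close> has the single
  point \<open>\<lambda>_. undefined\<close>. The measurable space \<open>S^j\<close> is the product of the Borel
  sigma-algebras; as \<open>S\<close> is second countable, this is the Borel sigma-algebra of the product topology.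
\<close>

definition prob_measures_on_power :: "nat \<Rightarrow> (nat \<Rightarrow> 'a::polish_space) measure set" where
  "prob_measures_on_power n =
     {\<nu>. prob_space \<nu> \<and> sets \<nu> = sets (PiM {1..n} (\<lambda>_. borel))}"

text \<open>
  Relative entropy of the first argument with respect to the second, valued in the extended reals.
  The library's \<open>KL_divergence\<close> is not used, since it is a Bochner integral and hence \<open>0\<close> when the
  log-density is not integrable. For \<open>\<nu> \<lless> \<mu>\<close> the integral of the negative part
  is at most \<open>1 / e\<close>, so the difference below is never \<open>\<infinity> - \<infinity>\<close>.
\<close>

definition rel_entropy :: "'b measure \<Rightarrow> 'b measure \<Rightarrow> ereal" where
  "rel_entropy \<nu> \<mu> =
     (if absolutely_continuous \<mu> \<nu>
      then enn2ereal (\<integral>\<^sup>+ x. ennreal (entropy_density (exp 1) \<mu> \<nu> x) \<partial>\<nu>)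
         - enn2ereal (\<integral>\<^sup>+ x. ennreal (- entropy_density (exp 1) \<mu> \<nu> x) \<partial>\<nu>)
      else \<infinity>)"

definition marginal :: "nat \<Rightarrow> (nat \<Rightarrow> 'a::polish_space) measure \<Rightarrow> (nat \<Rightarrow> 'a) measure" where
  "marginal j \<nu> = distr \<nu> (PiM {1..j} (\<lambda>_. borel)) (\<lambda>x. restrict x {1..j})"

definition entropy_constraint ::
    "nat \<Rightarrow> (nat \<Rightarrow> 'a::polish_space measure) \<Rightarrow> (nat \<Rightarrow> real) \<Rightarrow> nat \<Rightarrow> (nat \<Rightarrow> 'a) measure set" where
  "entropy_constraint n \<mu> \<gamma> j =
     {\<nu> \<in> prob_measures_on_power n.
        rel_entropy (marginal j \<nu>) (marginal j (PiM {1..n} \<mu>)) \<le> ereal ((\<Sum>k=1..j. \<gamma> k) * ln 2)}"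

definition Parisi_seqs :: "nat \<Rightarrow> (nat \<Rightarrow> real) set" where
  "Parisi_seqs n =
     {m \<in> extensional {1..n}. 0 < m 1 \<and> (\<forall>i\<in>{1..<n}. m i \<le> m (Suc i)) \<and> m n \<le> 1}"

text \<open>
  \<open>Parisi_rec n \<mu> m \<phi> j\<close> is the function \<open>\<phi>\<^sub>j\<close> on \<open>S^j\<close>; it is relevant for \<open>j \<le> n\<close> only. The recursion
  is downwards, starting from \<open>\<phi>\<^sub>n = \<phi>\<close>.
\<close>

function Parisi_rec ::
    "nat \<Rightarrow> (nat \<Rightarrow> 'a measure) \<Rightarrow> (nat \<Rightarrow> real) \<Rightarrow> ((nat \<Rightarrow> 'a) \<Rightarrow> real) \<Rightarrow> nat \<Rightarrow> (nat \<Rightarrow> 'a) \<Rightarrow> real" where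
  "Parisi_rec n \<mu> m \<phi> j =
     (if n \<le> j then \<phi>
      else (\<lambda>x. 1 / m (Suc j) *
              ln (\<integral>y. exp (m (Suc j) * Parisi_rec n \<mu> m \<phi> (Suc j) (x(Suc j := y))) \<partial>\<mu> (Suc j))))"
  by pat_completeness auto
termination
  by (relation "Wellfounded.measure (\<lambda>(n, _, _, _, j). n - j)") auto

declare Parisi_rec.simps [simp del]

definition Parisi ::
    "nat \<Rightarrow> (nat \<Rightarrow> 'a measure) \<Rightarrow> (nat \<Rightarrow> real) \<Rightarrow> (nat \<Rightarrow> real) \<Rightarrow> ((nat \<Rightarrow> 'a) \<Rightarrow> real) \<Rightarrow> real" where
  "Parisi n \<mu> \<gamma> m \<phi> =
     (\<Sum>i=1..n. \<gamma> i * ln 2 / m i) + Parisi_rec n \<mu> m \<phi> 0 (\<lambda>_. undefined) - ln 2"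

end

theory Submission
  imports Defs
begin

text \<open>
  The right-hand side is the Lagrange dual of the left-hand side: if \<open>l j \<ge> 0\<close> is the multiplier of
  the \<open>j\<close>-th entropy constraint, then the order parameter is \<open>1 / m i = 1 + (\<Sum>j=i..n. l j)\<close>.
  Let \<open>tilt j\<close> be the sum of \<open>m i * (\<phi>\<^sub>i - \<phi>\<^sub>i\<^sub>-\<^sub>1)\<close> over \<open>i \<le> j\<close>. By the recursion, \<open>exp (tilt j)\<close> is the
  density of the \<open>j\<close>-th marginal of the probability measure with density \<open>exp (tilt n)\<close>, and
  summation by parts gives \<open>\<phi> = \<phi>\<^sub>0 + tilt n + (\<Sum>j=1..n. l j * tilt j)\<close>. Weak duality is then the
  inequality \<open>\<integral>tilt j d\<nu> \<le> H(\<nu>\<^sup>(\<^sup>j\<^sup>) | \<mu>\<^sup>(\<^sup>j\<^sup>))\<close>. Conversely, a multiplier exists because \<open>\<mu>\<close> itself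
  satisfies all constraints strictly, and the Lagrangian evaluated at the density \<open>exp (tilt n)\<close>
  equals the Parisi functional. Strong duality only needs measures with bounded densities, for which
  all entropies are finite and convex.
\<close>

section \<open>Lagrange duality\<close>

text \<open>A point \<open>y\<close> with \<open>g y < 0\<close> forces
  \<open>l \<le> (p - F y) / (- g y)\<close>, and a point \<open>x\<close> with
  \<open>g x > 0\<close> forces \<open>l \<ge> (F x - p) / g x\<close>. So a multiplier exists once
  every lower bound lies below every upper bound, and the infimum of the upper bounds will do. The
  Slater point \<open>x0\<close> keeps the set of upper bounds nonempty. The first assumption is
  concavity of \<open>F\<close> and convexity of \<open>g\<close>, phrased without a vector space
  structure on \<open>C\<close>.\<close>

lemma lagrange_multiplier:
  fixes F g :: "'c \<Rightarrow> real"
  assumes mix: "\<And>x y t. x \<in> C \<Longrightarrow> y \<in> C \<Longrightarrow> 0 \<le> t \<Longrightarrow> t \<le> 1 \<Longrightarrow>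
      \<exists>z\<in>C. t * F x + (1 - t) * F y \<le> F z \<and> g z \<le> t * g x + (1 - t) * g y"
    and slater: "x0 \<in> C" "g x0 < 0"
    and bound: "\<And>x. x \<in> C \<Longrightarrow> g x \<le> 0 \<Longrightarrow> F x \<le> p"
  shows "\<exists>l\<ge>0. \<forall>x\<in>C. F x - l * g x \<le> p"
proof -
  define Q where "Q = (\<lambda>y. (p - F y) / (- g y)) ` {y\<in>C. g y < 0}"
  have ne: "Q \<noteq> {}" using slater by (auto simp: Q_def)
  have nonneg: "0 \<le> q" if q: "q \<in> Q" for q
  proof -
    obtain y where y: "y \<in> C" "g y < 0" "q = (p - F y) / (- g y)" using q by (auto simp: Q_def)
    show ?thesis unfolding y(3) using bound[OF y(1)] y(2) by (intro divide_nonneg_nonneg) auto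
  qed
  have bdd: "bdd_below Q" using nonneg by (meson bdd_belowI)
  have cross: "(F x - p) / g x \<le> (p - F y) / (- g y)"
    if xy: "x \<in> C" "g x > 0" "y \<in> C" "g y < 0" for x y
  proof -
    \<comment> \<open>The weight at which the average of \<open>g x\<close> and \<open>g y\<close>
      vanishes, so that the mixed point is feasible and has objective at most
      \<open>p\<close>.\<close>
    define t where "t = - g y / (g x - g y)"
    have t: "0 \<le> t" "t \<le> 1" "1 - t = g x / (g x - g y)"
      using that by (auto simp: t_def divide_simps)
    obtain z where z: "z \<in> C" "t * F x + (1 - t) * F y \<le> F z" "g z \<le> t * g x + (1 - t) * g y"
      using mix[OF xy(1,3) t(1,2)] by blast
    have "t * g x + (1 - t) * g y = 0"
      using that by (simp add: t(3)) (simp add: t_def field_simps)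
    then have "t * F x + (1 - t) * F y \<le> p"
      using bound[OF z(1)] z by linarith
    then have "(g x - g y) * (t * F x + (1 - t) * F y) \<le> (g x - g y) * p"
      using that by (intro mult_left_mono) auto
    moreover have "(g x - g y) * (t * F x + (1 - t) * F y) = - g y * F x + g x * F y"
    proof -
      have "(g x - g y) * t = - g y" "(g x - g y) * (1 - t) = g x"
        using that by (auto simp: t(3)) (auto simp: t_def)
      then show ?thesis by (metis distrib_left mult.assoc)
    qed
    ultimately show ?thesis using that by (simp add: divide_simps algebra_simps)
  qed
  have "F x - Inf Q * g x \<le> p" if x: "x \<in> C" for x
  proof (cases "g x" "0::real" rule: linorder_cases)
    case less
    then have "Inf Q \<le> (p - F x) / (- g x)"
      using x by (intro cInf_lower bdd) (auto simp: Q_def)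
    then show ?thesis using less by (simp add: field_simps)
  next
    case equal
    then show ?thesis using bound x by simp
  next
    case greater
    then have "(F x - p) / g x \<le> Inf Q"
      using x cross ne by (intro cInf_greatest) (auto simp: Q_def)
    then show ?thesis using greater by (simp add: field_simps)
  qed
  moreover have "0 \<le> Inf Q" using ne nonneg by (intro cInf_greatest) auto
  ultimately show ?thesis by blast
qed

text \<open>
  Each constraint is traded for a multiplier separately, so no separation theorem in a space whose
  dimension is the number of constraints is needed.
\<close>

lemma lagrange_multipliers:
  fixes F :: "'c \<Rightarrow> real" and g :: "'i \<Rightarrow> 'c \<Rightarrow> real"
  assumes "finite I"
    and "\<And>x y t. x \<in> C \<Longrightarrow> y \<in> C \<Longrightarrow> 0 \<le> t \<Longrightarrow> t \<le> 1 \<Longrightarrow>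
      \<exists>z\<in>C. t * F x + (1 - t) * F y \<le> F z \<and> (\<forall>i\<in>I. g i z \<le> t * g i x + (1 - t) * g i y)"
    and "x0 \<in> C" "\<And>i. i \<in> I \<Longrightarrow> g i x0 < 0"
    and "\<And>x. x \<in> C \<Longrightarrow> (\<And>i. i \<in> I \<Longrightarrow> g i x \<le> 0) \<Longrightarrow> F x \<le> p"
  shows "\<exists>l. (\<forall>i\<in>I. 0 \<le> l i) \<and> (\<forall>x\<in>C. F x - (\<Sum>i\<in>I. l i * g i x) \<le> p)"
  using assms
proof (induction I arbitrary: C rule: finite_induct)
  case empty
  then show ?case by auto
next
  case (insert a I)
  \<comment> \<open>The constraint \<open>a\<close> is first absorbed into the domain; convexity of
    \<open>g a\<close> keeps the smaller domain closed under mixing, which is why \<open>C\<close>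
    is arbitrary in the induction.\<close>
  define C' where "C' = {x\<in>C. g a x \<le> 0}"
  have "\<exists>l. (\<forall>i\<in>I. 0 \<le> l i) \<and> (\<forall>x\<in>C'. F x - (\<Sum>i\<in>I. l i * g i x) \<le> p)"
  proof (rule insert.IH)
    fix x y and t :: real
    assume xy: "x \<in> C'" "y \<in> C'" and t: "0 \<le> t" "t \<le> 1"
    then obtain z where z: "z \<in> C" "t * F x + (1 - t) * F y \<le> F z"
        "\<forall>i\<in>insert a I. g i z \<le> t * g i x + (1 - t) * g i y"
      using insert.prems(1)[of x y t] by (auto simp: C'_def)
    have "t * g a x + (1 - t) * g a y \<le> 0"
      using xy t by (auto simp: C'_def intro!: add_nonpos_nonpos mult_nonneg_nonpos)
    then have "z \<in> C'" using z by (force simp: C'_def)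
    then show "\<exists>z\<in>C'. t * F x + (1 - t) * F y \<le> F z \<and>
        (\<forall>i\<in>I. g i z \<le> t * g i x + (1 - t) * g i y)"
      using z by blast
  next
    show "x0 \<in> C'" using insert.prems(2,3) by (simp add: C'_def less_imp_le)
    show "g i x0 < 0" if "i \<in> I" for i using insert.prems(3) that by blast
    show "F x \<le> p" if "x \<in> C'" "\<And>i. i \<in> I \<Longrightarrow> g i x \<le> 0" for x
      using that by (intro insert.prems(4)) (auto simp: C'_def)
  qed
  then obtain l where l: "\<And>i. i \<in> I \<Longrightarrow> 0 \<le> l i"
      "\<And>x. x \<in> C' \<Longrightarrow> F x - (\<Sum>i\<in>I. l i * g i x) \<le> p"
    by blast
  \<comment> \<open>The multipliers of the other constraints are moved into the objective, which
    stays concave since they are nonnegative. Only the constraint \<open>a\<close> is then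
    left.\<close>
  define F' where "F' x = F x - (\<Sum>i\<in>I. l i * g i x)" for x
  have "\<exists>k\<ge>0. \<forall>x\<in>C. F' x - k * g a x \<le> p"
  proof (rule lagrange_multiplier)
    fix x y and t :: real
    assume xy: "x \<in> C" "y \<in> C" and t: "0 \<le> t" "t \<le> 1"
    then obtain z where z: "z \<in> C" "t * F x + (1 - t) * F y \<le> F z"
        "\<forall>i\<in>insert a I. g i z \<le> t * g i x + (1 - t) * g i y"
      using insert.prems(1)[of x y t] by auto
    have "(\<Sum>i\<in>I. l i * g i z) \<le> (\<Sum>i\<in>I. l i * (t * g i x + (1 - t) * g i y))"
      using z l by (intro sum_mono mult_left_mono) auto
    also have "\<dots> = t * (\<Sum>i\<in>I. l i * g i x) + (1 - t) * (\<Sum>i\<in>I. l i * g i y)"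
      by (simp add: sum_distrib_left sum.distrib algebra_simps sum_subtractf)
    finally have "t * F' x + (1 - t) * F' y \<le> F' z"
      using z(2) unfolding F'_def right_diff_distrib by linarith
    then show "\<exists>z\<in>C. t * F' x + (1 - t) * F' y \<le> F' z \<and> g a z \<le> t * g a x + (1 - t) * g a y"
      using z by blast
  next
    show "F' x \<le> p" if "x \<in> C" "g a x \<le> 0" for x
      using that l by (simp add: F'_def C'_def)
  qed (use insert.prems in auto)
  then obtain k where k: "k \<ge> 0" "\<And>x. x \<in> C \<Longrightarrow> F' x - k * g a x \<le> p" by blast
  have "(\<Sum>i\<in>insert a I. (l(a := k)) i * g i x) = k * g a x + (\<Sum>i\<in>I. l i * g i x)" for x
    using insert.hyps by (auto intro!: sum.cong)
  then show ?case using k l insert.hyps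
    by (intro exI[of _ "l(a := k)"]) (auto simp: F'_def algebra_simps)
qed

section \<open>Relative entropy\<close>

text \<open>The left side is the tangent at \<open>c\<close> of the convex function
  \<open>a * ln a\<close>; the inequality is \<open>ln u \<le> u - 1\<close> for
  \<open>u = c / a\<close>.\<close>

lemma mult_ln_ge_tangent:
  fixes a c :: real
  assumes "0 \<le> a" "0 < c"
  shows "a * ln c + a - c \<le> a * ln a"
proof (cases "a = 0")
  case False
  then have "ln (c / a) \<le> c / a - 1" using assms by (intro ln_le_minus_one) auto
  then have "a * (ln c - ln a) \<le> a * (c / a - 1)"
    using assms False by (intro mult_left_mono) (auto simp: ln_div)
  then show ?thesis using False by (simp add: algebra_simps)
qed (use assms in auto)

text \<open>Averaging the tangent inequality at \<open>c\<close> over the points \<open>a\<close>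
  and \<open>b\<close> gives the claim. The tangent needs \<open>c > 0\<close>; for
  \<open>c = 0\<close> both weighted terms vanish.\<close>

lemma mult_ln_convex:
  fixes a b t :: real
  assumes "0 \<le> a" "0 \<le> b" "0 \<le> t" "t \<le> 1"
  defines "c \<equiv> t * a + (1 - t) * b"
  shows "c * ln c \<le> t * (a * ln a) + (1 - t) * (b * ln b)"
proof (cases "c = 0")
  case True
  then have "t * a = 0" "(1 - t) * b = 0"
    using assms by (auto simp: c_def add_nonneg_eq_0_iff)
  then have "t * (a * ln a) = 0" "(1 - t) * (b * ln b) = 0" by auto
  then show ?thesis using True by (simp only: mult_zero_left add_0)
next
  case False
  then have c: "c > 0" using assms by (simp add: c_def order_less_le)
  have "t * (a * ln c + a - c) + (1 - t) * (b * ln c + b - c) \<le> t * (a * ln a) + (1 - t) * (b * ln b)"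
    using assms c by (intro add_mono mult_left_mono mult_ln_ge_tangent) auto
  moreover have "t * (a * ln c + a - c) + (1 - t) * (b * ln c + b - c) = c * ln c + c - c"
    unfolding c_def by (simp add: algebra_simps)
  ultimately show ?thesis by simp
qed

text \<open>A crude bound that serves to make \<open>f * ln f\<close> integrable for bounded
  \<open>f\<close>. It combines the tangent at 1 from below with \<open>ln a \<le> a\<close> from
  above.\<close>

lemma abs_mult_ln_le:
  fixes a b :: real
  assumes "0 \<le> a" "a \<le> b"
  shows "\<bar>a * ln a\<bar> \<le> 1 + b * b"
proof -
  have "a - 1 \<le> a * ln a" using mult_ln_ge_tangent[of a 1] assms by simp
  moreover have "a * ln a \<le> a * a"
  proof (cases "a = 0")
    case False
    then have "ln a \<le> a" using ln_le_minus_one[of a] assms by simp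
    then show ?thesis using assms by (intro mult_left_mono)
  qed auto
  moreover have "a * a \<le> b * b" using assms by (intro mult_mono) auto
  ultimately show ?thesis using assms by (smt (verit) mult_nonneg_nonneg)
qed

lemma enn2ereal_nn_integral_diff:
  fixes g :: "'b \<Rightarrow> real"
  assumes "integrable N g"
  shows "enn2ereal (\<integral>\<^sup>+x. ennreal (g x) \<partial>N) - enn2ereal (\<integral>\<^sup>+x. ennreal (- g x) \<partial>N)
    = ereal (\<integral>x. g x \<partial>N)"
proof -
  have fin: "(\<integral>\<^sup>+x. ennreal (g x) \<partial>N) < \<infinity>" "(\<integral>\<^sup>+x. ennreal (- g x) \<partial>N) < \<infinity>"
    using assms by (auto simp: real_integrable_def top.not_eq_extremum)
  then have "enn2ereal (\<integral>\<^sup>+x. ennreal (g x) \<partial>N) = ereal (enn2real (\<integral>\<^sup>+x. ennreal (g x) \<partial>N))"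
    "enn2ereal (\<integral>\<^sup>+x. ennreal (- g x) \<partial>N) = ereal (enn2real (\<integral>\<^sup>+x. ennreal (- g x) \<partial>N))"
    by (metis enn2ereal_ennreal enn2real_nonneg ennreal_enn2real infinity_ennreal_def)+
  then show ?thesis
    by (simp add: real_lebesgue_integral_def[OF assms])
qed

text \<open>By uniqueness \<open>f\<close> is the Radon-Nikodym derivative almost everywhere.
  Boundedness makes \<open>f * ln f\<close> integrable, so the difference of the two parts in
  \<open>rel_entropy\<close> collapses to one real integral.\<close>

lemma rel_entropy_density:
  fixes f :: "'b \<Rightarrow> real"
  assumes "prob_space M" and f[measurable]: "f \<in> borel_measurable M"
    and bounds: "\<And>x. x \<in> space M \<Longrightarrow> 0 \<le> f x \<and> f x \<le> B"
  shows "rel_entropy (density M f) M = ereal (\<integral>x. f x * ln (f x) \<partial>M)"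
proof -
  interpret prob_space M by fact
  let ?N = "density M (\<lambda>x. ennreal (f x))"
  have ac: "absolutely_continuous M ?N"
    by (rule absolutely_continuousI_density) simp
  have "AE x in M. ennreal (f x) = RN_deriv M ?N x"
    by (rule RN_deriv_unique) auto
  then have "AE x in M. entropy_density (exp 1) M ?N x = ln (f x)"
  proof (rule AE_mp, intro AE_I2 impI)
    fix x assume x: "x \<in> space M" and eq: "ennreal (f x) = RN_deriv M ?N x"
    show "entropy_density (exp 1) M ?N x = ln (f x)"
      using bounds[OF x] by (simp add: entropy_density_def log_def eq[symmetric])
  qed
  then have AE: "AE x in ?N. entropy_density (exp 1) M ?N x = ln (f x)"
    by (subst AE_density) auto
  have int: "integrable M (\<lambda>x. f x * ln (f x))"
    by (rule integrable_const_bound[where B = "1 + B * B"])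
       (use bounds abs_mult_ln_le in \<open>auto intro!: AE_I2\<close>)
  have fnonneg: "AE x in M. 0 \<le> f x" using bounds by auto
  have intN: "integrable ?N (\<lambda>x. ln (f x))"
    using int by (subst integrable_density) (use fnonneg in auto)
  have "(\<integral>\<^sup>+x. ennreal (entropy_density (exp 1) M ?N x) \<partial>?N) = (\<integral>\<^sup>+x. ennreal (ln (f x)) \<partial>?N)"
       "(\<integral>\<^sup>+x. ennreal (- entropy_density (exp 1) M ?N x) \<partial>?N) = (\<integral>\<^sup>+x. ennreal (- ln (f x)) \<partial>?N)"
    using AE by (auto intro!: nn_integral_cong_AE)
  then have "rel_entropy ?N M = ereal (\<integral>x. ln (f x) \<partial>?N)"
    using ac enn2ereal_nn_integral_diff[OF intN] by (simp add: rel_entropy_def)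
  also have "(\<integral>x. ln (f x) \<partial>?N) = (\<integral>x. f x * ln (f x) \<partial>M)"
    using fnonneg by (subst integral_density) auto
  finally show ?thesis .
qed

text \<open>One half of the Donsker--Varadhan formula.\<close>

lemma rel_entropy_ge_integral:
  fixes \<psi> :: "'b \<Rightarrow> real"
  assumes "prob_space M" "prob_space N" and sets[measurable_cong]: "sets N = sets M"
    and \<psi>[measurable]: "\<psi> \<in> borel_measurable M"
    and bounds: "\<And>x. x \<in> space M \<Longrightarrow> \<bar>\<psi> x\<bar> \<le> B"
    and exp_le: "(\<integral>\<^sup>+x. ennreal (exp (\<psi> x)) \<partial>M) \<le> 1"
  shows "ereal (\<integral>x. \<psi> x \<partial>N) \<le> rel_entropy N M"
proof (cases "absolutely_continuous M N")
  case True
  interpret M: prob_space M by fact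
  interpret N: prob_space N by fact
  have space: "space N = space M" using sets by (rule sets_eq_imp_space_eq)
  define f where "f = (\<lambda>x. enn2real (RN_deriv M N x))"
  have f[measurable]: "f \<in> borel_measurable M" by (simp add: f_def)
  have fN[measurable]: "f \<in> borel_measurable N" by measurable
  have f_nonneg: "0 \<le> f x" for x by (simp add: f_def)
  have "AE x in M. RN_deriv M N x \<noteq> \<infinity>"
    using True sets by (intro M.RN_deriv_finite) (auto intro: N.sigma_finite_measure_axioms)
  then have "density M f = density M (RN_deriv M N)"
    by (intro density_cong) (auto simp: f_def top.not_eq_extremum elim!: eventually_mono)
  also have "\<dots> = N" using True sets by (intro M.density_RN_deriv)
  finally have N: "density M f = N" .
  have nn: "(\<integral>\<^sup>+x. h x \<partial>N) = (\<integral>\<^sup>+x. ennreal (f x) * h x \<partial>M)" if "h \<in> borel_measurable M" for h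
    using that by (subst N[symmetric], subst nn_integral_density) auto
  have pos: "AE x in N. 0 < f x"
    by (subst N[symmetric], subst AE_density) (auto simp: ennreal_less_zero_iff)
  have ed: "entropy_density (exp 1) M N = (\<lambda>x. ln (f x))"
    by (simp add: entropy_density_def log_def f_def fun_eq_iff)
  have H: "rel_entropy N M =
      enn2ereal (\<integral>\<^sup>+x. ennreal (ln (f x)) \<partial>N) - enn2ereal (\<integral>\<^sup>+x. ennreal (- ln (f x)) \<partial>N)"
    using True by (simp add: rel_entropy_def ed)
  \<comment> \<open>The negative part of the log-density has integral at most 1, because
    \<open>- a * ln a \<le> 1\<close>. Hence the entropy is either infinite or a genuine integral,
    which are the two cases below.\<close>
  have "(\<integral>\<^sup>+x. ennreal (- ln (f x)) \<partial>N) = (\<integral>\<^sup>+x. ennreal (f x) * ennreal (- ln (f x)) \<partial>M)"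
    by (rule nn) measurable
  also have "\<dots> \<le> (\<integral>\<^sup>+x. 1 \<partial>M)"
  proof (rule nn_integral_mono)
    fix x
    have "f x * (- ln (f x)) \<le> 1"
      using mult_ln_ge_tangent[of "f x" 1] f_nonneg[of x] by (simp add: algebra_simps)
    then show "ennreal (f x) * ennreal (- ln (f x)) \<le> 1"
      by (metis ennreal_mult' ennreal_le_1 f_nonneg)
  qed
  finally have neg: "(\<integral>\<^sup>+x. ennreal (- ln (f x)) \<partial>N) \<le> 1" by (simp add: M.emeasure_space_1)
  show ?thesis
  proof (cases "(\<integral>\<^sup>+x. ennreal (ln (f x)) \<partial>N) = \<infinity>")
    case True
    then have "rel_entropy N M = \<infinity>"
      using neg unfolding H
      by (cases "(\<integral>\<^sup>+x. ennreal (- ln (f x)) \<partial>N)" rule: ennreal_cases) (auto simp: top_ereal_def)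
    then show ?thesis by simp
  next
    case False
    then have int: "integrable N (\<lambda>x. ln (f x))"
      using neg by (auto simp: real_integrable_def top_unique)
    \<comment> \<open>The ratio of \<open>exp \<psi>\<close> to the density of \<open>N\<close>. Its
      integral against \<open>N\<close> is at most that of \<open>exp \<psi>\<close> against
      \<open>M\<close>, with a loss where \<open>f\<close> vanishes and \<open>q\<close> is 0. Then
      \<open>ln q \<le> q - 1\<close> is integrated, as in the proof of Gibbs' inequality.\<close>
    define q where "q = (\<lambda>x. exp (\<psi> x) / f x)"
    have q[measurable]: "q \<in> borel_measurable M" unfolding q_def by measurable
    have qN[measurable]: "q \<in> borel_measurable N" by measurable
    have q_nonneg: "0 \<le> q x" for x by (simp add: q_def f_nonneg)
    have "(\<integral>\<^sup>+x. ennreal (q x) \<partial>N) = (\<integral>\<^sup>+x. ennreal (f x) * ennreal (q x) \<partial>M)"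
      by (rule nn) measurable
    also have "\<dots> \<le> (\<integral>\<^sup>+x. ennreal (exp (\<psi> x)) \<partial>M)"
      by (intro nn_integral_mono) (auto simp: q_def ennreal_mult'[symmetric] f_nonneg)
    also have "\<dots> \<le> 1" by (rule exp_le)
    finally have q_le: "(\<integral>\<^sup>+x. ennreal (q x) \<partial>N) \<le> 1" .
    have int_q: "integrable N q"
      by (rule integrableI_nonneg) (use q_le q_nonneg in \<open>auto simp: le_less_trans[OF _ ennreal_one_less_top]\<close>)
    have q_le1: "(\<integral>x. q x \<partial>N) \<le> 1"
      using q_le nn_integral_eq_integral[OF int_q] q_nonneg by (auto simp: ennreal_le_1)
    have int_\<psi>: "integrable N \<psi>"
      using bounds by (intro N.integrable_const_bound[where B = B]) (auto simp: space intro!: AE_I2)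
    have "(\<integral>x. \<psi> x - ln (f x) \<partial>N) \<le> (\<integral>x. q x - 1 \<partial>N)"
    proof (rule integral_mono_AE)
      show "AE x in N. \<psi> x - ln (f x) \<le> q x - 1"
        using pos
      proof (rule AE_mp, intro AE_I2 impI)
        fix x assume "0 < f x"
        then show "\<psi> x - ln (f x) \<le> q x - 1"
          using ln_le_minus_one[of "q x"] by (simp add: q_def ln_div)
      qed
    qed (use int int_\<psi> int_q in auto)
    also have "\<dots> \<le> 0" using q_le1 int_q by (simp add: N.prob_space)
    finally have "(\<integral>x. \<psi> x \<partial>N) \<le> (\<integral>x. ln (f x) \<partial>N)" using int int_\<psi> by simp
    then show ?thesis unfolding H enn2ereal_nn_integral_diff[OF int] by simp
  qed
qed (simp add: rel_entropy_def)

section \<open>Exponential tilting along the recursion\<close>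

declare One_nat_def [simp del]

text \<open>The assumptions range over all indices because \<open>product_prob_space\<close> asks
  for a probability measure at each of them; the final theorem adjusts the measures outside
  \<open>{1..n}\<close> to meet this.\<close>

locale priors =
  fixes n :: nat and \<mu> :: "nat \<Rightarrow> 'a::polish_space measure"
  assumes prob_\<mu>: "\<And>k. prob_space (\<mu> k)"
    and sets_\<mu>: "\<And>k. sets (\<mu> k) = sets borel"
begin

abbreviation M :: "nat \<Rightarrow> (nat \<Rightarrow> 'a) measure" where
  "M j \<equiv> PiM {1..j} \<mu>"

sublocale product_prob_space \<mu> "{1..n}"
  by (intro product_prob_space.intro product_sigma_finite.intro product_prob_space_axioms.intro
      prob_space_imp_sigma_finite prob_\<mu>)

lemma prob_M: "prob_space (M j)"
  by (intro prob_space_PiM prob_\<mu>)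

lemma sets_M: "sets (M j) = sets (PiM {1..j} (\<lambda>_. borel))"
  by (intro sets_PiM_cong sets_\<mu> refl)

lemma space_\<mu>: "space (\<mu> k) = UNIV"
  using sets_eq_imp_space_eq[OF sets_\<mu>] by simp

lemma restrict_measurable: "i \<le> j \<Longrightarrow> (\<lambda>x. restrict x {1..i}) \<in> measurable (M j) (M i)"
  by (intro measurable_restrict_subset) auto

lemma restrict_space: "i \<le> j \<Longrightarrow> x \<in> space (M j) \<Longrightarrow> restrict x {1..i} \<in> space (M i)"
  by (rule measurable_space[OF restrict_measurable])

lemma restrict_id: "x \<in> space (M j) \<Longrightarrow> restrict x {1..j} = x"
  by (simp add: space_PiM PiE_restrict)

lemma fun_upd_space: "x \<in> space (M j) \<Longrightarrow> x(Suc j := y) \<in> space (M (Suc j))"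
  by (auto simp: space_PiM space_\<mu> PiE_def extensional_def)

lemma marginal_eq: "marginal j \<nu> = distr \<nu> (M j) (\<lambda>x. restrict x {1..j})"
  unfolding marginal_def by (rule distr_cong) (simp_all add: sets_M)

lemma marginal_M: "j \<le> n \<Longrightarrow> marginal j (M n) = M j"
  unfolding marginal_eq by (rule distr_PiM_restrict_finite) auto

lemma sets_marginal: "sets (marginal j \<nu>) = sets (M j)"
  by (simp add: marginal_eq)

lemma restrict_measurable':
  assumes "sets \<nu> = sets (M n)" "j \<le> n"
  shows "(\<lambda>x. restrict x {1..j}) \<in> measurable \<nu> (M j)"
  using restrict_measurable[OF assms(2)] measurable_cong_sets[OF assms(1) refl] by blast

lemma prob_marginal:
  assumes "prob_space \<nu>" "sets \<nu> = sets (M n)" "j \<le> n"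
  shows "prob_space (marginal j \<nu>)"
  unfolding marginal_eq using assms by (intro prob_space.prob_space_distr restrict_measurable') auto

lemma marginal_top:
  assumes "sets \<nu> = sets (M n)"
  shows "marginal n \<nu> = \<nu>"
proof -
  have "distr \<nu> (M n) (\<lambda>x. restrict x {1..n}) = distr \<nu> \<nu> (\<lambda>x. x)"
    using assms sets_eq_imp_space_eq[OF assms] by (intro distr_cong) (auto simp: restrict_id)
  then show ?thesis by (simp add: marginal_eq distr_id)
qed

lemma emeasure_marginal:
  assumes "sets \<nu> = sets (M n)" "j \<le> n" "A \<in> sets (M j)"
  shows "emeasure (marginal j \<nu>) A = emeasure \<nu> ((\<lambda>x. restrict x {1..j}) -` A \<inter> space (M n))"
  unfolding marginal_eq using assms restrict_measurable'[OF assms(1,2)] sets_eq_imp_space_eq[OF assms(1)]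
  by (subst emeasure_distr) auto

end

section \<open>Regularity and normalization of the Parisi recursion\<close>

locale parisi = priors +
  fixes m :: "nat \<Rightarrow> real" and \<phi> :: "(nat \<Rightarrow> 'a) \<Rightarrow> real" and B :: real
  assumes m_pos: "\<And>k. k \<in> {1..n} \<Longrightarrow> 0 < m k"
    and \<phi>_measurable: "\<phi> \<in> borel_measurable (M n)"
    and \<phi>_bound: "\<And>x. x \<in> space (M n) \<Longrightarrow> \<bar>\<phi> x\<bar> \<le> B"
begin

abbreviation P :: "nat \<Rightarrow> (nat \<Rightarrow> 'a) \<Rightarrow> real" where
  "P j \<equiv> Parisi_rec n \<mu> m \<phi> j"

lemma P_top: "P n = \<phi>"
  by (simp add: Parisi_rec.simps)

lemma P_step:
  "j < n \<Longrightarrow> P j x = 1 / m (Suc j) * ln (\<integral>y. exp (m (Suc j) * P (Suc j) (x(Suc j := y))) \<partial>\<mu> (Suc j))"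
  by (subst Parisi_rec.simps) simp

lemma add_dim_measurable:
  "(\<lambda>(x, y). x(Suc j := y)) \<in> measurable (M j \<Otimes>\<^sub>M \<mu> (Suc j)) (M (Suc j))"
  using measurable_add_dim[of "Suc j" "{1..j}" \<mu>] by (simp add: atLeastAtMostSuc_conv)

lemma integral_exp_bounds:
  fixes g :: "'a \<Rightarrow> real"
  assumes [measurable]: "g \<in> borel_measurable (\<mu> k)" and g: "\<And>y. \<bar>g y\<bar> \<le> c"
  shows "integrable (\<mu> k) (\<lambda>y. exp (g y))"
    and "exp (- c) \<le> (\<integral>y. exp (g y) \<partial>\<mu> k)" "(\<integral>y. exp (g y) \<partial>\<mu> k) \<le> exp c"
proof -
  have g': "- c \<le> g y" "g y \<le> c" for y using g[of y] by auto
  show int: "integrable (\<mu> k) (\<lambda>y. exp (g y))"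
    using g' by (intro M.integrable_const_bound[where B = "exp c"]) auto
  show "exp (- c) \<le> (\<integral>y. exp (g y) \<partial>\<mu> k)"
    using g' int by (intro M.integral_ge_const) auto
  show "(\<integral>y. exp (g y) \<partial>\<mu> k) \<le> exp c"
    using g' int by (intro M.integral_le_const) auto
qed

lemma P_section_measurable:
  assumes "P (Suc j) \<in> borel_measurable (M (Suc j))" "x \<in> space (M j)"
  shows "(\<lambda>y. P (Suc j) (x(Suc j := y))) \<in> borel_measurable (\<mu> (Suc j))"
proof -
  have "(\<lambda>p. P (Suc j) (case p of (x, y) \<Rightarrow> x(Suc j := y))) \<in> borel_measurable (M j \<Otimes>\<^sub>M \<mu> (Suc j))"
    by (rule measurable_compose[OF add_dim_measurable assms(1)])
  from measurable_Pair2[OF this assms(2)] show ?thesis by simp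
qed

text \<open>Both properties descend together, since the bound is what keeps the exponential integral
  finite and positive. The same \<open>B\<close> serves at every level because \<open>1 / m\<close>
  times the logarithm of the mean of \<open>exp (m * g)\<close> lies between the bounds of
  \<open>g\<close>.\<close>

lemma P_measurable_bounded:
  assumes "j \<le> n"
  shows "P j \<in> borel_measurable (M j) \<and> (\<forall>x\<in>space (M j). \<bar>P j x\<bar> \<le> B)"
  using assms
proof (induction rule: inc_induct)
  case base
  show ?case using \<phi>_measurable \<phi>_bound by (simp add: P_top)
next
  case (step j)
  let ?m = "m (Suc j)"
  have m: "0 < ?m" using step.hyps by (intro m_pos) auto
  have meas: "P (Suc j) \<in> borel_measurable (M (Suc j))"
    and bound: "\<And>x. x \<in> space (M (Suc j)) \<Longrightarrow> \<bar>P (Suc j) x\<bar> \<le> B"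
    using step.IH by auto
  have "(\<lambda>p. P (Suc j) (case p of (x, y) \<Rightarrow> x(Suc j := y))) \<in> borel_measurable (M j \<Otimes>\<^sub>M \<mu> (Suc j))"
    by (rule measurable_compose[OF add_dim_measurable meas])
  then have [measurable]: "(\<lambda>(x, y). P (Suc j) (x(Suc j := y))) \<in> borel_measurable (M j \<Otimes>\<^sub>M \<mu> (Suc j))"
    by (simp add: case_prod_beta)
  have "P j \<in> borel_measurable (M j)"
    unfolding P_step[OF step.hyps(2), abs_def] by measurable
  moreover have "\<bar>P j x\<bar> \<le> B" if x: "x \<in> space (M j)" for x
  proof -
    let ?I = "\<integral>y. exp (?m * P (Suc j) (x(Suc j := y))) \<partial>\<mu> (Suc j)"
    have "\<bar>?m * P (Suc j) (x(Suc j := y))\<bar> \<le> ?m * B" for y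
      using bound[OF fun_upd_space[OF x]] m by (simp add: abs_mult)
    then have I: "exp (- (?m * B)) \<le> ?I" "?I \<le> exp (?m * B)"
      using P_section_measurable[OF meas x]
        integral_exp_bounds[of "\<lambda>y. ?m * P (Suc j) (x(Suc j := y))" "Suc j" "?m * B"] by simp_all
    have "0 < ?I" by (rule less_le_trans[OF exp_gt_zero I(1)])
    then have "- (?m * B) \<le> ln ?I" "ln ?I \<le> ?m * B"
      using I by (auto simp: ln_ge_iff) (metis exp_le_cancel_iff exp_ln)
    then show ?thesis
      unfolding P_step[OF step.hyps(2)] using m by (auto simp: abs_le_iff field_simps)
  qed
  ultimately show ?case by blast
qed

lemma P_measurable: "j \<le> n \<Longrightarrow> P j \<in> borel_measurable (M j)"
  and P_bound: "j \<le> n \<Longrightarrow> x \<in> space (M j) \<Longrightarrow> \<bar>P j x\<bar> \<le> B"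
  using P_measurable_bounded by auto

text \<open>The recursion makes \<open>exp (m (Suc j) * P j x)\<close> the normalizing constant of
  \<open>exp (m (Suc j) * P (Suc j))\<close> in the last coordinate. The integrand is thus a
  conditional density of coordinate \<open>Suc j\<close> given the first \<open>j\<close>.\<close>

lemma nn_integral_exp_P:
  assumes j: "j < n" and x: "x \<in> space (M j)"
  shows "(\<integral>\<^sup>+y. ennreal (exp (m (Suc j) * (P (Suc j) (x(Suc j := y)) - P j x))) \<partial>\<mu> (Suc j)) = 1"
proof -
  let ?m = "m (Suc j)"
  let ?I = "\<integral>y. exp (?m * P (Suc j) (x(Suc j := y))) \<partial>\<mu> (Suc j)"
  have m: "0 < ?m" using j by (intro m_pos) auto
  have meas[measurable]: "(\<lambda>y. P (Suc j) (x(Suc j := y))) \<in> borel_measurable (\<mu> (Suc j))"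
    using j by (intro P_section_measurable P_measurable x) auto
  have "\<bar>?m * P (Suc j) (x(Suc j := y))\<bar> \<le> ?m * B" for y
    using P_bound[of "Suc j", OF _ fun_upd_space[OF x]] j m by (simp add: abs_mult)
  then have int: "integrable (\<mu> (Suc j)) (\<lambda>y. exp (?m * P (Suc j) (x(Suc j := y))))"
    and "exp (- (?m * B)) \<le> ?I"
    using integral_exp_bounds[of "\<lambda>y. ?m * P (Suc j) (x(Suc j := y))" "Suc j" "?m * B"] by simp_all
  then have "0 < ?I" by (meson exp_gt_zero less_le_trans)
  then have I: "exp (?m * P j x) = ?I" using m by (simp add: P_step[OF j])
  have "(\<integral>\<^sup>+y. ennreal (exp (?m * (P (Suc j) (x(Suc j := y)) - P j x))) \<partial>\<mu> (Suc j))
      = (\<integral>\<^sup>+y. ennreal (exp (?m * P (Suc j) (x(Suc j := y))) / ?I) \<partial>\<mu> (Suc j))"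
    by (simp add: right_diff_distrib exp_diff I)
  also have "\<dots> = ennreal (\<integral>y. exp (?m * P (Suc j) (x(Suc j := y))) / ?I \<partial>\<mu> (Suc j))"
    using int \<open>0 < ?I\<close> by (intro nn_integral_eq_integral) auto
  also have "\<dots> = 1" using \<open>0 < ?I\<close> by simp
  finally show ?thesis .
qed

text \<open>The logarithm of a product of conditional densities. The restrictions let
  \<open>tilt j\<close> be evaluated directly at points with more than \<open>j\<close>
  coordinates.\<close>

definition tilt :: "nat \<Rightarrow> (nat \<Rightarrow> 'a) \<Rightarrow> real" where
  "tilt j x = (\<Sum>i=1..j. m i * (P i (restrict x {1..i}) - P (i - 1) (restrict x {1..i - 1})))"

lemma tilt_restrict: "tilt j (restrict x {1..j}) = tilt j x"
  unfolding tilt_def by (intro sum.cong refl arg_cong2[where f = "(*)"] arg_cong2[where f = "(-)"]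
      arg_cong[where f = "P _"]) (auto simp: Int_absorb1)

lemma tilt_Suc:
  assumes "x \<in> space (M j)"
  shows "tilt (Suc j) (x(Suc j := y)) = tilt j x + m (Suc j) * (P (Suc j) (x(Suc j := y)) - P j x)"
proof -
  let ?z = "x(Suc j := y)"
  have r: "restrict ?z {1..i} = restrict x {1..i}" if "i \<le> j" for i
    using that by (auto simp: restrict_def fun_eq_iff)
  have "tilt j ?z = tilt j x" by (metis tilt_restrict r order_refl)
  moreover have "tilt (Suc j) ?z = tilt j ?z +
      m (Suc j) * (P (Suc j) (restrict ?z {1..Suc j}) - P j (restrict ?z {1..j}))"
    by (simp add: tilt_def)
  ultimately show ?thesis
    by (simp only: r[OF order_refl] restrict_id[OF assms] restrict_id[OF fun_upd_space[OF assms]])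
qed

lemma tilt_measurable:
  assumes "j \<le> n"
  shows "tilt j \<in> borel_measurable (M j)"
proof -
  have "(\<lambda>x. P i (restrict x {1..i})) \<in> borel_measurable (M j)" if "i \<le> j" for i
    using that assms by (intro measurable_compose[OF restrict_measurable P_measurable]) auto
  then show ?thesis unfolding tilt_def[abs_def]
    by (intro borel_measurable_sum borel_measurable_times borel_measurable_diff) auto
qed

lemma tilt_bound:
  assumes "j \<le> n" "x \<in> space (M j)"
  shows "\<bar>tilt j x\<bar> \<le> (\<Sum>i=1..j. m i * (2 * B))"
proof -
  have P: "\<bar>P i (restrict x {1..i})\<bar> \<le> B" if "i \<le> j" for i
    using that assms by (intro P_bound restrict_space) auto
  show ?thesis unfolding tilt_def
  proof (rule order_trans[OF sum_abs sum_mono])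
    fix i assume "i \<in> {1..j}"
    then have "0 < m i" "\<bar>P i (restrict x {1..i})\<bar> \<le> B" "\<bar>P (i - 1) (restrict x {1..i - 1})\<bar> \<le> B"
      using assms P m_pos by auto
    then show "\<bar>m i * (P i (restrict x {1..i}) - P (i - 1) (restrict x {1..i - 1}))\<bar> \<le> m i * (2 * B)"
      unfolding abs_mult by (intro mult_mono) auto
  qed
qed

text \<open>Integrating out the last coordinate removes the last conditional density, which has mass
  one; the set \<open>A\<close> sees only the first \<open>k\<close> coordinates and passes through.
  Induction removes the coordinates above \<open>k\<close> one by one.\<close>

lemma nn_integral_exp_tilt:
  assumes "k \<le> j" "j \<le> n" and A: "A \<in> sets (M k)"
  shows "(\<integral>\<^sup>+x. ennreal (exp (tilt j x)) * indicator A (restrict x {1..k}) \<partial>M j)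
    = (\<integral>\<^sup>+x. ennreal (exp (tilt k x)) * indicator A x \<partial>M k)"
  using assms(1,2)
proof (induction rule: dec_induct)
  case base
  show ?case by (intro nn_integral_cong) (simp add: restrict_id)
next
  case (step j)
  let ?F = "\<lambda>x. ennreal (exp (tilt (Suc j) x)) * indicator A (restrict x {1..k})"
  have [measurable]: "tilt (Suc j) \<in> borel_measurable (M (Suc j))" by (intro tilt_measurable step.prems)
  have [measurable]: "(\<lambda>x. restrict x {1..k}) \<in> measurable (M (Suc j)) (M k)"
    using step.hyps by (intro restrict_measurable) auto
  note A[measurable]
  have "?F \<in> borel_measurable (M (Suc j))" by measurable
  then have "(\<integral>\<^sup>+x. ?F x \<partial>M (Suc j)) = (\<integral>\<^sup>+x. (\<integral>\<^sup>+y. ?F (x(Suc j := y)) \<partial>\<mu> (Suc j)) \<partial>M j)"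
    using product_nn_integral_insert[of "{1..j}" "Suc j" ?F] by (simp add: atLeastAtMostSuc_conv)
  also have "\<dots> = (\<integral>\<^sup>+x. ennreal (exp (tilt j x)) * indicator A (restrict x {1..k}) \<partial>M j)"
  proof (rule nn_integral_cong)
    fix x assume x: "x \<in> space (M j)"
    have r: "restrict (x(Suc j := y)) {1..k} = restrict x {1..k}" for y
      using step.hyps by (auto simp: restrict_def fun_eq_iff)
    have [measurable]: "(\<lambda>y. P (Suc j) (x(Suc j := y))) \<in> borel_measurable (\<mu> (Suc j))"
      using step.prems by (intro P_section_measurable P_measurable x) auto
    have "(\<integral>\<^sup>+y. ?F (x(Suc j := y)) \<partial>\<mu> (Suc j)) =
      (\<integral>\<^sup>+y. ennreal (exp (tilt j x)) * indicator A (restrict x {1..k}) *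
        ennreal (exp (m (Suc j) * (P (Suc j) (x(Suc j := y)) - P j x))) \<partial>\<mu> (Suc j))"
      by (intro nn_integral_cong) (simp only: tilt_Suc[OF x] r exp_add ennreal_mult'' exp_ge_zero ac_simps)
    also have "\<dots> = ennreal (exp (tilt j x)) * indicator A (restrict x {1..k})"
      using step.prems by (subst nn_integral_cmult) (simp_all add: nn_integral_exp_P[OF _ x])
    finally show "(\<integral>\<^sup>+y. ?F (x(Suc j := y)) \<partial>\<mu> (Suc j)) =
        ennreal (exp (tilt j x)) * indicator A (restrict x {1..k})" .
  qed
  also have "\<dots> = (\<integral>\<^sup>+x. ennreal (exp (tilt k x)) * indicator A x \<partial>M k)"
    using step.prems by (intro step.IH) auto
  finally show ?case .
qed

lemma nn_integral_exp_tilt_eq_1: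
  assumes "j \<le> n"
  shows "(\<integral>\<^sup>+x. ennreal (exp (tilt j x)) \<partial>M j) = 1"
proof -
  \<comment> \<open>All coordinates are integrated out, down to the one-point space
    \<open>M 0\<close>, where \<open>tilt 0\<close> is an empty sum.\<close>
  have "(\<integral>\<^sup>+x. ennreal (exp (tilt j x)) \<partial>M j)
      = (\<integral>\<^sup>+x. ennreal (exp (tilt j x)) * indicator (space (M 0)) (restrict x {1..0}) \<partial>M j)"
    by (intro nn_integral_cong) (simp add: space_PiM restrict_def)
  also have "\<dots> = (\<integral>\<^sup>+x. ennreal (exp (tilt 0 x)) * indicator (space (M 0)) x \<partial>M 0)"
    using assms by (intro nn_integral_exp_tilt) auto
  also have "\<dots> = 1"
    using prob_space.emeasure_space_1[OF prob_M[of 0]] by (simp add: tilt_def)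
  finally show ?thesis .
qed

text \<open>Tests both measures on a set of \<open>M j\<close> through
  \<open>nn_integral_exp_tilt\<close>. All marginals of the tilted measure, and hence their
  entropies, become explicit.\<close>

lemma marginal_density_tilt:
  assumes j: "j \<le> n"
  shows "marginal j (density (M n) (\<lambda>x. exp (tilt n x))) = density (M j) (\<lambda>x. exp (tilt j x))"
proof (rule measure_eqI)
  fix A assume "A \<in> sets (marginal j (density (M n) (\<lambda>x. exp (tilt n x))))"
  then have A: "A \<in> sets (M j)" by (simp add: sets_marginal)
  have [measurable]: "tilt j \<in> borel_measurable (M j)" "tilt n \<in> borel_measurable (M n)"
    using j by (auto intro: tilt_measurable)
  let ?A = "(\<lambda>x. restrict x {1..j}) -` A \<inter> space (M n)"
  have "?A \<in> sets (M n)" by (rule measurable_sets[OF restrict_measurable[OF j] A])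
  then have "emeasure (marginal j (density (M n) (\<lambda>x. exp (tilt n x)))) A
      = (\<integral>\<^sup>+x. ennreal (exp (tilt n x)) * indicator ?A x \<partial>M n)"
    using A j by (subst emeasure_marginal) (auto simp: emeasure_density)
  also have "\<dots> = (\<integral>\<^sup>+x. ennreal (exp (tilt n x)) * indicator A (restrict x {1..j}) \<partial>M n)"
    by (intro nn_integral_cong) (auto simp: indicator_def)
  also have "\<dots> = (\<integral>\<^sup>+x. ennreal (exp (tilt j x)) * indicator A x \<partial>M j)"
    using A j by (intro nn_integral_exp_tilt) auto
  finally show "emeasure (marginal j (density (M n) (\<lambda>x. exp (tilt n x)))) A
      = emeasure (density (M j) (\<lambda>x. exp (tilt j x))) A"
    using A by (subst emeasure_density) auto
qed (simp add: sets_marginal)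

lemma integral_tilt_marginal:
  assumes "sets \<nu> = sets (M n)" "j \<le> n"
  shows "(\<integral>x. tilt j x \<partial>marginal j \<nu>) = (\<integral>x. tilt j x \<partial>\<nu>)"
  unfolding marginal_eq using assms
  by (subst integral_distr) (auto intro: restrict_measurable' tilt_measurable simp: tilt_restrict)

end

section \<open>Multipliers, summation by parts and weak duality\<close>

lemma sum_triangle_swap:
  fixes f :: "nat \<Rightarrow> nat \<Rightarrow> real"
  shows "(\<Sum>j=1..n. \<Sum>i=1..j. f i j) = (\<Sum>i=1..n. \<Sum>j=i..n. f i j)"
proof -
  have "(\<Sum>j=1..n. \<Sum>i=1..j. f i j) = (\<Sum>j=1..n. \<Sum>i | i \<in> {1..n} \<and> i \<le> j. f i j)"
    by (intro sum.cong) auto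
  also have "\<dots> = (\<Sum>i=1..n. \<Sum>j | j \<in> {1..n} \<and> i \<le> j. f i j)"
    by (rule sum.swap_restrict) auto
  also have "\<dots> = (\<Sum>i=1..n. \<Sum>j=i..n. f i j)" by (intro sum.cong) auto
  finally show ?thesis .
qed

text \<open>
  The parameters \<open>l\<close> are the Lagrange multipliers of the entropy constraints; the order parameter
  \<open>m\<close> is a reparametrisation of them.
\<close>

locale parisi_multipliers = parisi +
  fixes l :: "nat \<Rightarrow> real"
  assumes inverse_m: "\<And>i. i \<in> {1..n} \<Longrightarrow> 1 / m i = 1 + (\<Sum>j=i..n. l j)"
begin

text \<open>After exchanging the sums, the increment \<open>m i * d i\<close> carries the
  coefficient \<open>1 + (\<Sum>j=i..n. l j) = 1 / m i\<close>. What remains is the telescoping sum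
  of the \<open>d i\<close>, which is \<open>\<phi>\<close> minus its value at level 0.\<close>

lemma \<phi>_decomposition:
  assumes x: "x \<in> space (M n)"
  shows "\<phi> x = P 0 (\<lambda>_. undefined) + tilt n x + (\<Sum>j=1..n. l j * tilt j x)"
proof -
  define d where "d i = P i (restrict x {1..i}) - P (i - 1) (restrict x {1..i - 1})" for i
  have t: "tilt j x = (\<Sum>i=1..j. m i * d i)" for j by (simp add: tilt_def d_def)
  have "(\<Sum>j=1..n. l j * tilt j x) = (\<Sum>j=1..n. \<Sum>i=1..j. l j * (m i * d i))"
    by (simp add: t sum_distrib_left)
  also have "\<dots> = (\<Sum>i=1..n. \<Sum>j=i..n. l j * (m i * d i))" by (rule sum_triangle_swap)
  also have "\<dots> = (\<Sum>i=1..n. d i - m i * d i)"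
  proof (intro sum.cong refl)
    fix i assume i: "i \<in> {1..n}"
    have "(\<Sum>j=i..n. l j * (m i * d i)) = (1 / m i - 1) * (m i * d i)"
      by (simp add: inverse_m[OF i] sum_distrib_right)
    also have "\<dots> = d i - m i * d i" using m_pos[OF i] by (simp add: left_diff_distrib)
    finally show "(\<Sum>j=i..n. l j * (m i * d i)) = d i - m i * d i" .
  qed
  also have "\<dots> = (\<Sum>i=1..n. d i) - tilt n x" by (simp add: sum_subtractf t)
  \<comment> \<open>At the lower end, the restriction to the empty set \<open>{1..0}\<close> is
    \<open>\<lambda>_. undefined\<close>, the point at which \<open>Parisi\<close> evaluates the
    recursion.\<close>
  also have "(\<Sum>i=1..k. d i) = P k (restrict x {1..k}) - P 0 (\<lambda>_. undefined)" for k
    by (induction k) (auto simp: d_def restrict_def)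
  finally show ?thesis by (simp only: restrict_id[OF x] P_top)
qed

text \<open>Each \<open>tilt j\<close> depends on the first \<open>j\<close> coordinates only, so
  its integral is moved to the marginal, where it can be compared with the entropy.\<close>

lemma integral_\<phi>:
  assumes "prob_space \<nu>" and sets: "sets \<nu> = sets (M n)"
  shows "(\<integral>x. \<phi> x \<partial>\<nu>) = P 0 (\<lambda>_. undefined) + (\<integral>x. tilt n x \<partial>marginal n \<nu>)
    + (\<Sum>j=1..n. l j * (\<integral>x. tilt j x \<partial>marginal j \<nu>))"
proof -
  interpret \<nu>: prob_space \<nu> by fact
  have space: "space \<nu> = space (M n)" using sets by (rule sets_eq_imp_space_eq)
  have int: "integrable \<nu> (tilt j)" if j: "j \<le> n" for j
  proof (rule \<nu>.integrable_const_bound)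
    show "AE x in \<nu>. norm (tilt j x) \<le> (\<Sum>i=1..j. m i * (2 * B))"
      using tilt_bound[OF j restrict_space[OF j]] by (auto simp: space tilt_restrict)
    have "(\<lambda>x. tilt j (restrict x {1..j})) \<in> borel_measurable \<nu>"
      by (rule measurable_compose[OF restrict_measurable'[OF sets j] tilt_measurable[OF j]])
    then show "tilt j \<in> borel_measurable \<nu>" by (simp add: tilt_restrict)
  qed
  have "(\<integral>x. \<phi> x \<partial>\<nu>) =
      (\<integral>x. P 0 (\<lambda>_. undefined) + tilt n x + (\<Sum>j=1..n. l j * tilt j x) \<partial>\<nu>)"
    by (intro Bochner_Integration.integral_cong refl \<phi>_decomposition) (simp add: space)
  also have "\<dots> = P 0 (\<lambda>_. undefined) + (\<integral>x. tilt n x \<partial>\<nu>) + (\<Sum>j=1..n. l j * (\<integral>x. tilt j x \<partial>\<nu>))"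
  proof -
    have "(\<integral>x. (\<Sum>j=1..n. l j * tilt j x) \<partial>\<nu>) = (\<Sum>j=1..n. l j * (\<integral>x. tilt j x \<partial>\<nu>))"
      using int by (subst Bochner_Integration.integral_sum) auto
    moreover have "integrable \<nu> (\<lambda>x. \<Sum>j=1..n. l j * tilt j x)"
      using int by (intro Bochner_Integration.integrable_sum) auto
    ultimately show ?thesis using int[of n] by (simp add: \<nu>.prob_space)
  qed
  finally show ?thesis using sets by (simp add: integral_tilt_marginal)
qed

text \<open>The summand 1 in \<open>1 / m i\<close> contributes \<open>ln 2\<close> in total and
  cancels the final \<open>- ln 2\<close>. Exchanging the remaining sums pairs each multiplier with
  the level of its constraint, as in a Lagrangian dual function.\<close>

lemma Parisi_eq:
  assumes "(\<Sum>k=1..n. \<gamma> k) = 1"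
  shows "Parisi n \<mu> \<gamma> m \<phi> = P 0 (\<lambda>_. undefined) + (\<Sum>j=1..n. l j * ((\<Sum>k=1..j. \<gamma> k) * ln 2))"
proof -
  have "(\<Sum>i=1..n. \<gamma> i * ln 2 / m i) = (\<Sum>i=1..n. \<gamma> i * ln 2 + (\<Sum>j=i..n. l j * (\<gamma> i * ln 2)))"
  proof (intro sum.cong refl)
    fix i assume i: "i \<in> {1..n}"
    have "\<gamma> i * ln 2 / m i = (1 + (\<Sum>j=i..n. l j)) * (\<gamma> i * ln 2)"
      by (simp flip: inverse_m[OF i])
    then show "\<gamma> i * ln 2 / m i = \<gamma> i * ln 2 + (\<Sum>j=i..n. l j * (\<gamma> i * ln 2))"
      by (simp only: distrib_right mult_1 sum_distrib_right)
  qed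
  also have "\<dots> = (\<Sum>i=1..n. \<gamma> i) * ln 2 + (\<Sum>i=1..n. \<Sum>j=i..n. l j * (\<gamma> i * ln 2))"
    by (simp only: sum.distrib sum_distrib_right)
  also have "(\<Sum>i=1..n. \<Sum>j=i..n. l j * (\<gamma> i * ln 2)) = (\<Sum>j=1..n. \<Sum>i=1..j. l j * (\<gamma> i * ln 2))"
    by (rule sum_triangle_swap[symmetric])
  also have "\<dots> = (\<Sum>j=1..n. l j * ((\<Sum>k=1..j. \<gamma> k) * ln 2))"
    by (simp only: sum_distrib_left sum_distrib_right)
  finally show ?thesis using assms by (simp add: Parisi_def)
qed

text \<open>
  The multipliers turn the objective into a nonnegative combination of terms
  \<open>\<integral>tilt j d\<nu>\<close>, each of which is at most the entropy of the \<open>j\<close>-th marginal.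
\<close>

lemma weak_duality:
  assumes n: "1 \<le> n" and l: "\<And>j. j \<in> {1..n} \<Longrightarrow> 0 \<le> l j"
    and \<gamma>: "(\<Sum>k=1..n. \<gamma> k) = 1"
    and \<nu>: "\<nu> \<in> (\<Inter>j\<in>{1..n}. entropy_constraint n \<mu> \<gamma> j)"
  shows "ereal (\<integral>x. \<phi> x \<partial>\<nu>) - rel_entropy \<nu> (M n) \<le> ereal (Parisi n \<mu> \<gamma> m \<phi>)"
proof -
  have "\<nu> \<in> prob_measures_on_power n" using \<nu> n by (auto simp: entropy_constraint_def)
  then have prob: "prob_space \<nu>" and sets: "sets \<nu> = sets (M n)"
    by (auto simp: prob_measures_on_power_def sets_M)
  define a where "a j = (\<integral>x. tilt j x \<partial>marginal j \<nu>)" for j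
  have a: "ereal (a j) \<le> rel_entropy (marginal j \<nu>) (M j)" if "j \<in> {1..n}" for j
    unfolding a_def using that prob sets
    by (intro rel_entropy_ge_integral[where B = "\<Sum>i=1..j. m i * (2 * B)"] tilt_bound prob_M prob_marginal sets_marginal tilt_measurable)
       (auto simp: nn_integral_exp_tilt_eq_1)
  have "a j \<le> (\<Sum>k=1..j. \<gamma> k) * ln 2" if j: "j \<in> {1..n}" for j
  proof -
    have "rel_entropy (marginal j \<nu>) (M j) \<le> ereal ((\<Sum>k=1..j. \<gamma> k) * ln 2)"
      using \<nu> j by (auto simp: entropy_constraint_def marginal_M)
    with a[OF j] show ?thesis by (metis ereal_less_eq(3) order_trans)
  qed
  then have "(\<Sum>j=1..n. l j * a j) \<le> (\<Sum>j=1..n. l j * ((\<Sum>k=1..j. \<gamma> k) * ln 2))"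
    using l by (intro sum_mono mult_left_mono) auto
  then have "(\<integral>x. \<phi> x \<partial>\<nu>) - a n \<le> Parisi n \<mu> \<gamma> m \<phi>"
    unfolding Parisi_eq[OF \<gamma>] integral_\<phi>[OF prob sets] a_def by simp
  \<comment> \<open>The term \<open>a n\<close> with coefficient one, left over besides the
    multiplier terms, is paid for by the entropy in the objective.\<close>
  moreover have "ereal (a n) \<le> rel_entropy \<nu> (M n)"
    using a[of n] n marginal_top[OF sets] by simp
  then have "ereal (\<integral>x. \<phi> x \<partial>\<nu>) - rel_entropy \<nu> (M n) \<le> ereal ((\<integral>x. \<phi> x \<partial>\<nu>) - a n)"
    by (simp flip: ereal_minus(1) add: ereal_minus_mono)
  ultimately show ?thesis by (meson ereal_less_eq(3) order_trans)
qed

end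

section \<open>Families of bounded densities\<close>

lemma emeasure_density_mix:
  fixes f g :: "'b \<Rightarrow> real"
  assumes [measurable]: "f \<in> borel_measurable M" "g \<in> borel_measurable M" "A \<in> sets M"
    and nonneg: "\<And>x. x \<in> space M \<Longrightarrow> 0 \<le> f x" "\<And>x. x \<in> space M \<Longrightarrow> 0 \<le> g x"
    and t: "0 \<le> t" "t \<le> 1"
  shows "emeasure (density M (\<lambda>x. t * f x + (1 - t) * g x)) A
    = ennreal t * emeasure (density M f) A + ennreal (1 - t) * emeasure (density M g) A"
proof -
  have "emeasure (density M (\<lambda>x. t * f x + (1 - t) * g x)) A
      = (\<integral>\<^sup>+x. ennreal t * (ennreal (f x) * indicator A x)
          + ennreal (1 - t) * (ennreal (g x) * indicator A x) \<partial>M)"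
    using t nonneg
    by (subst emeasure_density)
       (auto intro!: nn_integral_cong simp: ennreal_plus ennreal_mult distrib_right mult.assoc)
  then show ?thesis by (simp add: nn_integral_add nn_integral_cmult emeasure_density)
qed

context priors
begin

text \<open>An element is a whole family: \<open>f n\<close> is the density of a measure and
  \<open>f j\<close> that of its \<open>j\<close>-th marginal. With all levels as data, the
  entropies are real numbers and mixing acts pointwise on each level.\<close>

definition bounded_densities :: "(nat \<Rightarrow> (nat \<Rightarrow> 'a) \<Rightarrow> real) set" where
  "bounded_densities = {f. prob_space (density (M n) (f n)) \<and>
     (\<forall>j\<in>{1..n}. f j \<in> borel_measurable (M j) \<and>
        (\<exists>b. \<forall>x\<in>space (M j). 0 \<le> f j x \<and> f j x \<le> b) \<and>
        marginal j (density (M n) (f n)) = density (M j) (f j))}"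

definition ent :: "nat \<Rightarrow> (nat \<Rightarrow> (nat \<Rightarrow> 'a) \<Rightarrow> real) \<Rightarrow> real" where
  "ent j f = (\<integral>x. f j x * ln (f j x) \<partial>M j)"

lemma bounded_densitiesD:
  assumes "f \<in> bounded_densities"
  shows "prob_space (density (M n) (f n))"
    and "j \<in> {1..n} \<Longrightarrow> f j \<in> borel_measurable (M j)"
    and "j \<in> {1..n} \<Longrightarrow> \<exists>b. \<forall>x\<in>space (M j). 0 \<le> f j x \<and> f j x \<le> b"
    and "j \<in> {1..n} \<Longrightarrow> marginal j (density (M n) (f n)) = density (M j) (f j)"
  using assms by (auto simp: bounded_densities_def)

lemma rel_entropy_bounded_densities:
  assumes f: "f \<in> bounded_densities" and j: "j \<in> {1..n}"
  shows "rel_entropy (marginal j (density (M n) (f n))) (M j) = ereal (ent j f)"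
proof -
  obtain b where "\<And>x. x \<in> space (M j) \<Longrightarrow> 0 \<le> f j x \<and> f j x \<le> b"
    using bounded_densitiesD(3)[OF f j] by blast
  then show ?thesis
    unfolding bounded_densitiesD(4)[OF f j] ent_def
    by (intro rel_entropy_density prob_M bounded_densitiesD(2)[OF f j])
qed

lemma integrable_mult_ln:
  assumes f: "f \<in> bounded_densities" and j: "j \<in> {1..n}"
  shows "integrable (M j) (\<lambda>x. f j x * ln (f j x))"
proof -
  obtain b where b: "\<And>x. x \<in> space (M j) \<Longrightarrow> 0 \<le> f j x \<and> f j x \<le> b"
    using bounded_densitiesD(3)[OF f j] by blast
  have [measurable]: "f j \<in> borel_measurable (M j)" by (rule bounded_densitiesD(2)[OF f j])
  show ?thesis
    by (rule finite_measure.integrable_const_bound[OF prob_space.finite_measure[OF prob_M], where B = "1 + b * b"])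
       (use b abs_mult_ln_le in \<open>auto intro!: AE_I2\<close>)
qed

definition mix :: "real \<Rightarrow> (nat \<Rightarrow> (nat \<Rightarrow> 'a) \<Rightarrow> real) \<Rightarrow> (nat \<Rightarrow> (nat \<Rightarrow> 'a) \<Rightarrow> real) \<Rightarrow>
    nat \<Rightarrow> (nat \<Rightarrow> 'a) \<Rightarrow> real" where
  "mix t f g j x = t * f j x + (1 - t) * g j x"

text \<open>The measure with the mixed density is the mixture of the two measures, and taking
  marginals commutes with mixtures, so mixing level by level keeps the family consistent.\<close>

lemma mix_bounded_densities:
  assumes n: "1 \<le> n" and f: "f \<in> bounded_densities" and g: "g \<in> bounded_densities"
    and t: "0 \<le> t" "t \<le> 1"
  shows "mix t f g \<in> bounded_densities"
proof -
  note [measurable] = bounded_densitiesD(2)[OF f] bounded_densitiesD(2)[OF g]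
  have nonneg: "0 \<le> f j x" "0 \<le> g j x" if "x \<in> space (M j)" "j \<in> {1..n}" for x j
    using bounded_densitiesD(3)[OF f that(2)] bounded_densitiesD(3)[OF g that(2)] that(1) by auto
  have n': "n \<in> {1..n}" using n by simp
  have em: "emeasure (density (M j) (mix t f g j)) A
      = ennreal t * emeasure (density (M j) (f j)) A + ennreal (1 - t) * emeasure (density (M j) (g j)) A"
    if j: "j \<in> {1..n}" and A: "A \<in> sets (M j)" for j A
    unfolding mix_def using t A nonneg j
    by (intro emeasure_density_mix bounded_densitiesD(2)[OF f j] bounded_densitiesD(2)[OF g j]) auto
  have meas: "mix t f g j \<in> borel_measurable (M j)" if j: "j \<in> {1..n}" for j
    unfolding mix_def[abs_def] using bounded_densitiesD(2)[OF f j] bounded_densitiesD(2)[OF g j] by simp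
  have "prob_space (density (M n) (mix t f g n))"
  proof (rule prob_spaceI)
    have "emeasure (density (M n) (f n)) (space (M n)) = 1" "emeasure (density (M n) (g n)) (space (M n)) = 1"
      using prob_space.emeasure_space_1[OF bounded_densitiesD(1)[OF f]]
        prob_space.emeasure_space_1[OF bounded_densitiesD(1)[OF g]] by simp_all
    then show "emeasure (density (M n) (mix t f g n)) (space (density (M n) (mix t f g n))) = 1"
      using em[OF n'] t by (simp flip: ennreal_plus)
  qed
  moreover have "\<exists>b. \<forall>x\<in>space (M j). 0 \<le> mix t f g j x \<and> mix t f g j x \<le> b" if j: "j \<in> {1..n}" for j
  proof -
    obtain b c where "\<forall>x\<in>space (M j). 0 \<le> f j x \<and> f j x \<le> b" "\<forall>x\<in>space (M j). 0 \<le> g j x \<and> g j x \<le> c"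
      using bounded_densitiesD(3)[OF f j] bounded_densitiesD(3)[OF g j] by blast
    then have "\<forall>x\<in>space (M j). 0 \<le> mix t f g j x \<and> mix t f g j x \<le> t * b + (1 - t) * c"
      unfolding mix_def using t by (auto intro!: add_mono mult_left_mono add_nonneg_nonneg)
    then show ?thesis by blast
  qed
  moreover have "marginal j (density (M n) (mix t f g n)) = density (M j) (mix t f g j)"
    if j: "j \<in> {1..n}" for j
  proof (rule measure_eqI)
    fix A assume "A \<in> sets (marginal j (density (M n) (mix t f g n)))"
    then have A: "A \<in> sets (M j)" by (simp add: sets_marginal)
    let ?A = "(\<lambda>x. restrict x {1..j}) -` A \<inter> space (M n)"
    have A': "?A \<in> sets (M n)" using j by (intro measurable_sets[OF restrict_measurable A]) auto
    have marg: "emeasure (marginal j (density (M n) (h n))) A = emeasure (density (M n) (h n)) ?A"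
      for h :: "nat \<Rightarrow> (nat \<Rightarrow> 'a) \<Rightarrow> real"
      using j A by (intro emeasure_marginal) auto
    show "emeasure (marginal j (density (M n) (mix t f g n))) A = emeasure (density (M j) (mix t f g j)) A"
      by (simp only: marg em[OF n' A'] em[OF j A] marg[symmetric, of f] marg[symmetric, of g]
          bounded_densitiesD(4)[OF f j] bounded_densitiesD(4)[OF g j])
  qed (simp add: sets_marginal)
  ultimately show ?thesis using meas by (auto simp: bounded_densities_def)
qed

lemma ent_mix:
  assumes n: "1 \<le> n" and f: "f \<in> bounded_densities" and g: "g \<in> bounded_densities"
    and t: "0 \<le> t" "t \<le> 1" and j: "j \<in> {1..n}"
  shows "ent j (mix t f g) \<le> t * ent j f + (1 - t) * ent j g"
proof -
  have "ent j (mix t f g) \<le> (\<integral>x. t * (f j x * ln (f j x)) + (1 - t) * (g j x * ln (g j x)) \<partial>M j)"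
    unfolding ent_def
  proof (rule integral_mono)
    show "integrable (M j) (\<lambda>x. mix t f g j x * ln (mix t f g j x))"
      by (intro integrable_mult_ln mix_bounded_densities n f g t j)
    show "integrable (M j) (\<lambda>x. t * (f j x * ln (f j x)) + (1 - t) * (g j x * ln (g j x)))"
      using integrable_mult_ln[OF f j] integrable_mult_ln[OF g j] by auto
    show "mix t f g j x * ln (mix t f g j x) \<le> t * (f j x * ln (f j x)) + (1 - t) * (g j x * ln (g j x))"
      if "x \<in> space (M j)" for x
      unfolding mix_def using bounded_densitiesD(3)[OF f j] bounded_densitiesD(3)[OF g j] that t
      by (intro mult_ln_convex) auto
  qed
  also have "\<dots> = t * ent j f + (1 - t) * ent j g"
    unfolding ent_def using integrable_mult_ln[OF f j] integrable_mult_ln[OF g j] by simp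
  finally show ?thesis .
qed

text \<open>The number \<open>p\<close> is any real upper bound of the primal problem.
  \<open>lagrange_multipliers\<close> bounds the Lagrangian by \<open>p\<close> on all bounded
  densities; the parameter built from the multipliers yields a test density at which the Lagrangian
  is exactly the Parisi functional.\<close>

lemma strong_duality:
  fixes \<phi> :: "(nat \<Rightarrow> 'a) \<Rightarrow> real"
  assumes n: "1 \<le> n"
    and \<phi>[measurable]: "\<phi> \<in> borel_measurable (M n)"
    and bound: "\<And>x. x \<in> space (M n) \<Longrightarrow> \<bar>\<phi> x\<bar> \<le> B"
    and \<gamma>_pos: "\<And>k. k \<in> {1..n} \<Longrightarrow> 0 < \<gamma> k" and \<gamma>_sum: "(\<Sum>k=1..n. \<gamma> k) = 1"
    and sup: "\<And>\<nu>. \<nu> \<in> (\<Inter>j\<in>{1..n}. entropy_constraint n \<mu> \<gamma> j) \<Longrightarrow>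
        ereal (\<integral>x. \<phi> x \<partial>\<nu>) - rel_entropy \<nu> (M n) \<le> ereal p"
  shows "\<exists>m\<in>Parisi_seqs n. Parisi n \<mu> \<gamma> m \<phi> \<le> p"
proof -
  have n': "n \<in> {1..n}" using n by simp
  define F where "F f = (\<integral>x. f n x * \<phi> x \<partial>M n) - ent n f" for f :: "nat \<Rightarrow> (nat \<Rightarrow> 'a) \<Rightarrow> real"
  define G where "G j = (\<Sum>k=1..j. \<gamma> k) * ln 2" for j
  have G_pos: "0 < G j" if "j \<in> {1..n}" for j
    unfolding G_def using that \<gamma>_pos by (intro mult_pos_pos sum_pos) auto
  have int: "integrable (M n) (\<lambda>x. f n x * \<phi> x)" if f: "f \<in> bounded_densities" for f
  proof -
    obtain b where b: "\<And>x. x \<in> space (M n) \<Longrightarrow> 0 \<le> f n x \<and> f n x \<le> b"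
      using bounded_densitiesD(3)[OF f n'] by blast
    have "\<bar>f n x * \<phi> x\<bar> \<le> b * B" if "x \<in> space (M n)" for x
      unfolding abs_mult using b[OF that] bound[OF that] by (intro mult_mono) auto
    then show ?thesis
      using bounded_densitiesD(2)[OF f n'] by (intro P.integrable_const_bound[where B = "b * B"]) auto
  qed
  have "\<exists>l. (\<forall>j\<in>{1..n}. 0 \<le> l j) \<and> (\<forall>f\<in>bounded_densities. F f - (\<Sum>j\<in>{1..n}. l j * (ent j f - G j)) \<le> p)"
  proof (rule lagrange_multipliers[where ?x0.0 = "\<lambda>_ _. 1"])
    fix f g and t :: real
    assume f: "f \<in> bounded_densities" and g: "g \<in> bounded_densities" and t: "0 \<le> t" "t \<le> 1"
    have "(\<integral>x. mix t f g n x * \<phi> x \<partial>M n) = (\<integral>x. t * (f n x * \<phi> x) + (1 - t) * (g n x * \<phi> x) \<partial>M n)"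
      by (intro Bochner_Integration.integral_cong) (auto simp: mix_def algebra_simps)
    also have "\<dots> = t * (\<integral>x. f n x * \<phi> x \<partial>M n) + (1 - t) * (\<integral>x. g n x * \<phi> x \<partial>M n)"
      using int[OF f] int[OF g] by simp
    finally have "t * F f + (1 - t) * F g \<le> F (mix t f g)"
      using ent_mix[OF n f g t n'] by (simp add: F_def right_diff_distrib)
    moreover have "ent j (mix t f g) - G j \<le> t * (ent j f - G j) + (1 - t) * (ent j g - G j)"
      if "j \<in> {1..n}" for j
    proof -
      have "t * (ent j f - G j) + (1 - t) * (ent j g - G j) = t * ent j f + (1 - t) * ent j g - G j"
        by (simp add: algebra_simps)
      with ent_mix[OF n f g t that] show ?thesis by linarith
    qed
    ultimately show "\<exists>h\<in>bounded_densities. t * F f + (1 - t) * F g \<le> F h \<and>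
        (\<forall>j\<in>{1..n}. ent j h - G j \<le> t * (ent j f - G j) + (1 - t) * (ent j g - G j))"
      using mix_bounded_densities[OF n f g t] by blast
  next
    \<comment> \<open>The constant family 1 stands for the product measure itself. Its entropies are
      0, strictly below the levels \<open>G j\<close>, which makes it the Slater point.\<close>
    have one: "density (M j) (\<lambda>_. ennreal 1) = M j" for j by (simp add: density_1)
    show "(\<lambda>_ _. 1) \<in> bounded_densities"
      by (auto simp: bounded_densities_def one density_1 marginal_M prob_M)
    show "ent j (\<lambda>_ _. 1) - G j < 0" if "j \<in> {1..n}" for j
      using G_pos[OF that] by (simp add: ent_def)
  next
    fix f assume f: "f \<in> bounded_densities" and feas: "\<And>j. j \<in> {1..n} \<Longrightarrow> ent j f - G j \<le> 0"
    let ?\<nu> = "density (M n) (f n)"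
    have "?\<nu> \<in> (\<Inter>j\<in>{1..n}. entropy_constraint n \<mu> \<gamma> j)"
      using feas bounded_densitiesD(1)[OF f]
      by (auto simp: entropy_constraint_def prob_measures_on_power_def sets_M marginal_M
          rel_entropy_bounded_densities[OF f] G_def)
    from sup[OF this] have "ereal (\<integral>x. \<phi> x \<partial>?\<nu>) - ereal (ent n f) \<le> ereal p"
      using rel_entropy_bounded_densities[OF f n'] by (simp add: marginal_top)
    moreover have "(\<integral>x. \<phi> x \<partial>?\<nu>) = (\<integral>x. f n x * \<phi> x \<partial>M n)"
      using bounded_densitiesD(2,3)[OF f n'] by (subst integral_density) auto
    ultimately show "F f \<le> p" by (simp add: F_def)
  qed simp
  then obtain l where l: "\<And>j. j \<in> {1..n} \<Longrightarrow> 0 \<le> l j"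
    and dual: "\<And>f. f \<in> bounded_densities \<Longrightarrow> F f - (\<Sum>j=1..n. l j * (ent j f - G j)) \<le> p"
    by blast
  \<comment> \<open>The equation \<open>inverse_m\<close> solved for \<open>m\<close>. Nonnegative
    multipliers make the sequence nondecreasing and bounded by 1; the value \<open>undefined\<close>
    outside \<open>{1..n}\<close> makes it extensional.\<close>
  define m where "m i = (if i \<in> {1..n} then 1 / (1 + (\<Sum>j=i..n. l j)) else undefined)" for i
  have s: "0 \<le> (\<Sum>j=i..n. l j)" if "1 \<le> i" for i using that l by (intro sum_nonneg) auto
  interpret parisi_multipliers n \<mu> m \<phi> B l
    using s bound by unfold_locales (auto simp: m_def add_pos_nonneg)
  have m: "m \<in> Parisi_seqs n"
    unfolding Parisi_seqs_def
  proof (intro CollectI conjI ballI)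
    show "m i \<le> m (Suc i)" if "i \<in> {1..<n}" for i
    proof -
      have "(\<Sum>j=i..n. l j) = l i + (\<Sum>j=Suc i..n. l j)" using that by (intro sum.atLeast_Suc_atMost) auto
      then show ?thesis using that l[of i] s[of "Suc i"] by (auto simp: m_def intro!: divide_left_mono)
    qed
    show "m n \<le> 1" using n s[of n] by (auto simp: m_def)
  qed (use n m_pos in \<open>auto simp: m_def extensional_def\<close>)
  define f where "f j x = exp (tilt j x)" for j x
  have f_eq: "f j = (\<lambda>x. exp (tilt j x))" for j by (simp add: f_def fun_eq_iff)
  let ?\<nu> = "density (M n) (f n)"
  have f: "f \<in> bounded_densities"
    unfolding bounded_densities_def
  proof (intro CollectI conjI ballI)
    show "prob_space ?\<nu>"
    proof (rule prob_spaceI)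
      show "emeasure ?\<nu> (space ?\<nu>) = 1"
        using nn_integral_exp_tilt_eq_1[of n] tilt_measurable[of n]
        by (simp add: f_eq emeasure_density cong: nn_integral_cong)
    qed
    fix j assume j: "j \<in> {1..n}"
    then show "f j \<in> borel_measurable (M j)"
      unfolding f_eq using tilt_measurable[of j] by simp
    show "marginal j ?\<nu> = density (M j) (f j)"
      unfolding f_eq using j by (intro marginal_density_tilt) auto
    have "f j x \<le> exp (\<Sum>i=1..j. m i * (2 * B))" if "x \<in> space (M j)" for x
      using tilt_bound[of j x] j that by (simp add: f_def)
    then show "\<exists>b. \<forall>x\<in>space (M j). 0 \<le> f j x \<and> f j x \<le> b"
      by (auto simp: f_def)
  qed
  \<comment> \<open>Here \<open>ln (f j)\<close> is \<open>tilt j\<close>, so the entropy inequality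
    behind weak duality becomes an equality at every level.\<close>
  have ent: "ent j f = (\<integral>x. tilt j x \<partial>marginal j ?\<nu>)" if j: "j \<in> {1..n}" for j
    unfolding bounded_densitiesD(4)[OF f j] ent_def using tilt_measurable[of j] j
    by (subst integral_density) (auto simp: f_eq)
  have "(\<integral>x. f n x * \<phi> x \<partial>M n) = (\<integral>x. \<phi> x \<partial>?\<nu>)"
    using bounded_densitiesD(2)[OF f n'] by (subst integral_density) (auto simp: f_eq)
  also have "\<dots> = P 0 (\<lambda>_. undefined) + ent n f + (\<Sum>j=1..n. l j * ent j f)"
    using integral_\<phi>[of ?\<nu>] bounded_densitiesD(1)[OF f] n by (simp add: ent)
  finally have "Parisi n \<mu> \<gamma> m \<phi> = F f - (\<Sum>j=1..n. l j * (ent j f - G j))"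
    by (simp add: F_def Parisi_eq[OF \<gamma>_sum] G_def right_diff_distrib sum_subtractf)
  then have "Parisi n \<mu> \<gamma> m \<phi> \<le> p" using dual[OF f] by (simp only:)
  then show ?thesis using m by blast
qed

end

section \<open>The variational formula\<close>

text \<open>The recursion reads the measures at the indices \<open>1..n\<close> only; this permits
  changing them elsewhere so that \<open>priors\<close> applies.\<close>

lemma Parisi_rec_cong:
  assumes "\<And>k. k \<in> {1..n} \<Longrightarrow> \<mu> k = \<mu>' k"
  shows "Parisi_rec n \<mu> m \<phi> j = Parisi_rec n \<mu>' m \<phi> j"
proof (cases "j \<le> n")
  case True
  then show ?thesis
  proof (induction rule: inc_induct)
    case (step j)
    then have "\<mu> (Suc j) = \<mu>' (Suc j)" by (intro assms) auto
    with step show ?case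
      by (subst (1 2) Parisi_rec.simps) simp
  qed (simp add: Parisi_rec.simps)
qed (simp add: Parisi_rec.simps)

text \<open>Composition with \<open>restrict\<close> extends \<open>\<phi>\<close> to a continuous
  function on all of \<open>nat \<Rightarrow> 'a\<close>, where the Borel sets form the product
  sigma-algebra. The result is pulled back along the inclusion of the extensional functions.\<close>

lemma continuous_map_product_borel_measurable:
  fixes \<phi> :: "(nat \<Rightarrow> 'a::polish_space) \<Rightarrow> real"
  assumes "continuous_map (product_topology (\<lambda>_. euclidean) I) euclideanreal \<phi>"
  shows "\<phi> \<in> borel_measurable (PiM I (\<lambda>_. borel))"
proof -
  have "continuous_map (product_topology (\<lambda>_. euclidean) UNIV) (product_topology (\<lambda>_. euclidean) I)
      (\<lambda>x::nat \<Rightarrow> 'a. restrict x I)"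
    by (auto simp: continuous_map_componentwise intro!: continuous_map_product_projection)
  from continuous_map_compose[OF this assms]
  have "continuous_on UNIV (\<lambda>x. \<phi> (restrict x I))"
    by (simp add: euclidean_product_topology o_def)
  then have "(\<lambda>x. \<phi> (restrict x I)) \<in> borel_measurable borel"
    by (rule borel_measurable_continuous_onI)
  then have m: "(\<lambda>x. \<phi> (restrict x I)) \<in> borel_measurable (PiM UNIV (\<lambda>_. borel))"
    by (subst measurable_cong_sets[OF sets_PiM_equal_borel refl])
  \<comment> \<open>The inclusion is measurable coordinatewise: a coordinate outside
    \<open>I\<close> is the constant \<open>undefined\<close>.\<close>
  have meas: "(\<lambda>x i. x i) \<in> measurable (PiM I (\<lambda>_. borel)) (PiM UNIV (\<lambda>_. borel::'a measure))"
  proof (rule measurable_PiM_single')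
    fix i
    show "(\<lambda>x. x i) \<in> measurable (PiM I (\<lambda>_. borel)) (borel::'a measure)"
    proof (cases "i \<in> I")
      case False
      then have "(\<lambda>x. x i) \<in> measurable (PiM I (\<lambda>_. borel)) (borel::'a measure)
          \<longleftrightarrow> (\<lambda>x. undefined) \<in> measurable (PiM I (\<lambda>_. borel::'a measure)) (borel::'a measure)"
        by (intro measurable_cong) (auto simp: space_PiM elim: PiE_arb)
      then show ?thesis by simp
    qed (rule measurable_component_singleton)
  qed (auto simp: space_PiM)
  from measurable_compose[OF meas m]
  have "(\<lambda>x. \<phi> (restrict x I)) \<in> borel_measurable (PiM I (\<lambda>_. borel))" by simp
  moreover have "\<phi> (restrict x I) = \<phi> x" if "x \<in> space (PiM I (\<lambda>_. borel :: 'a measure))" for x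
    using that by (simp add: space_PiM PiE_restrict)
  ultimately show ?thesis by (rule measurable_cong[THEN iffD1, rotated])
qed

section \<open>From order parameters to multipliers\<close>

lemma Parisi_seqs_pos:
  assumes "m \<in> Parisi_seqs n" "k \<in> {1..n}"
  shows "0 < m k"
proof -
  have "1 \<le> k" "k \<le> n" using assms(2) by auto
  then show ?thesis
  proof (induction rule: dec_induct)
    case base
    then show ?case using assms(1) by (simp add: Parisi_seqs_def)
  next
    case (step i)
    then have "m i \<le> m (Suc i)" using assms(1) by (simp add: Parisi_seqs_def)
    with step show ?case by simp
  qed
qed

text \<open>The multipliers are the successive decrements of \<open>1 / m\<close>. They are
  nonnegative because \<open>m\<close> is nondecreasing and, for the last one, because
  \<open>m n \<le> 1\<close>.\<close>

lemma Parisi_seqs_multipliers: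
  assumes m: "m \<in> Parisi_seqs n"
  obtains l where "\<And>j. j \<in> {1..n} \<Longrightarrow> 0 \<le> l j"
    and "\<And>i. i \<in> {1..n} \<Longrightarrow> 1 / m i = 1 + (\<Sum>j=i..n. l j)"
proof
  \<comment> \<open>The value 1 beyond \<open>n\<close> turns the last decrement into
    \<open>1 / m n - 1\<close> and makes the sum of the decrements from \<open>i\<close> on equal to
    \<open>1 / m i - 1\<close>.\<close>
  define c where "c j = (if j \<le> n then 1 / m j else 1)" for j
  define l where "l j = c j - c (Suc j)" for j
  have c: "c (Suc n) = 1" by (simp add: c_def)
  show "0 \<le> l j" if j: "j \<in> {1..n}" for j
  proof (cases "j = n")
    case True
    then show ?thesis
      using m Parisi_seqs_pos[OF m j] by (auto simp: l_def c_def Parisi_seqs_def)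
  next
    case False
    then have "m j \<le> m (Suc j)" using m j by (auto simp: Parisi_seqs_def)
    then show ?thesis
      using False j Parisi_seqs_pos[OF m j] by (auto simp: l_def c_def intro!: divide_left_mono)
  qed
  show "1 / m i = 1 + (\<Sum>j=i..n. l j)" if i: "i \<in> {1..n}" for i
  proof -
    have "(\<Sum>j=i..n. l j) = c i - c (Suc n)"
      using i sum_Suc_diff[of i "Suc n" "\<lambda>j. - c j"] unfolding l_def
      by (simp add: atLeastLessThanSuc_atLeastAtMost)
    then show ?thesis using i c by (simp add: c_def)
  qed
qed

theorem theorem2p5:
  fixes n :: nat
    and \<mu> :: "nat \<Rightarrow> 'a::polish_space measure"
    and \<gamma> :: "nat \<Rightarrow> real"
    and \<phi> :: "(nat \<Rightarrow> 'a) \<Rightarrow> real"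
  assumes n_ge_1: "1 \<le> n"
    and prob_\<mu>: "\<And>k. k \<in> {1..n} \<Longrightarrow> prob_space (\<mu> k)"
    and sets_\<mu>: "\<And>k. k \<in> {1..n} \<Longrightarrow> sets (\<mu> k) = sets borel"
    and \<gamma>_pos: "\<And>k. k \<in> {1..n} \<Longrightarrow> 0 < \<gamma> k"
    and \<gamma>_sum: "(\<Sum>k=1..n. \<gamma> k) = 1"
    and \<phi>_bounded: "bounded (\<phi> ` ({1..n} \<rightarrow>\<^sub>E UNIV))"
    and \<phi>_continuous: "continuous_map (product_topology (\<lambda>_. euclidean) {1..n}) euclideanreal \<phi>"
  shows "(SUP \<nu> \<in> (\<Inter>j\<in>{1..n}. entropy_constraint n \<mu> \<gamma> j).
            ereal (\<integral>x. \<phi> x \<partial>\<nu>) - rel_entropy \<nu> (PiM {1..n} \<mu>))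
       = (INF m \<in> Parisi_seqs n. ereal (Parisi n \<mu> \<gamma> m \<phi>))"
proof -
  \<comment> \<open>Point masses fill the indices outside \<open>{1..n}\<close>, so that
    \<open>priors\<close> can be interpreted; the equations below show that both sides of the claim
    are unchanged.\<close>
  define \<mu>' where "\<mu>' k = (if k \<in> {1..n} then \<mu> k else return borel undefined)" for k
  have \<mu>': "\<mu>' k = \<mu> k" if "k \<in> {1..n}" for k using that by (simp add: \<mu>'_def)
  interpret priors n \<mu>'
  proof (rule priors.intro)
    show "prob_space (\<mu>' k)" for k
      using prob_\<mu>[of k] prob_space_return[of undefined borel] by (cases "k \<in> {1..n}") (simp_all add: \<mu>'_def)
    show "sets (\<mu>' k) = sets borel" for k
      using sets_\<mu>[of k] by (cases "k \<in> {1..n}") (simp_all add: \<mu>'_def)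
  qed
  have PiM: "PiM {1..n} \<mu> = M n" by (intro PiM_cong) (auto simp: \<mu>')
  have constraint: "entropy_constraint n \<mu> \<gamma> j = entropy_constraint n \<mu>' \<gamma> j" for j
    by (simp add: entropy_constraint_def PiM)
  have Parisi: "Parisi n \<mu> \<gamma> m \<phi> = Parisi n \<mu>' \<gamma> m \<phi>" for m
    unfolding Parisi_def by (subst Parisi_rec_cong[of n \<mu> \<mu>']) (auto simp: \<mu>')
  have \<phi>: "\<phi> \<in> borel_measurable (M n)"
    using continuous_map_product_borel_measurable[OF \<phi>_continuous]
    by (simp add: measurable_cong_sets[OF sets_M refl])
  obtain B where "\<And>y. y \<in> \<phi> ` ({1..n} \<rightarrow>\<^sub>E UNIV) \<Longrightarrow> \<bar>y\<bar> \<le> B"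
    using \<phi>_bounded by (auto simp: bounded_iff)
  then have B: "\<bar>\<phi> x\<bar> \<le> B" if "x \<in> space (M n)" for x
    using that by (auto simp: space_PiM space_\<mu>)
  show ?thesis
    unfolding PiM constraint Parisi
  proof (rule antisym)
    show "(SUP \<nu> \<in> (\<Inter>j\<in>{1..n}. entropy_constraint n \<mu>' \<gamma> j). ereal (\<integral>x. \<phi> x \<partial>\<nu>) - rel_entropy \<nu> (M n))
        \<le> (INF m \<in> Parisi_seqs n. ereal (Parisi n \<mu>' \<gamma> m \<phi>))"
    proof (intro SUP_least INF_greatest)
      fix \<nu> m assume \<nu>: "\<nu> \<in> (\<Inter>j\<in>{1..n}. entropy_constraint n \<mu>' \<gamma> j)" and m: "m \<in> Parisi_seqs n"
      obtain l where l: "\<And>j. j \<in> {1..n} \<Longrightarrow> 0 \<le> l j"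
        "\<And>i. i \<in> {1..n} \<Longrightarrow> 1 / m i = 1 + (\<Sum>j=i..n. l j)"
        using Parisi_seqs_multipliers[OF m] by blast
      interpret parisi_multipliers n \<mu>' m \<phi> B l
        by unfold_locales (use Parisi_seqs_pos[OF m] \<phi> B l in auto)
      show "ereal (\<integral>x. \<phi> x \<partial>\<nu>) - rel_entropy \<nu> (M n) \<le> ereal (Parisi n \<mu>' \<gamma> m \<phi>)"
        by (rule weak_duality[OF n_ge_1 l(1) \<gamma>_sum \<nu>])
    qed
  next
    show "(INF m \<in> Parisi_seqs n. ereal (Parisi n \<mu>' \<gamma> m \<phi>))
        \<le> (SUP \<nu> \<in> (\<Inter>j\<in>{1..n}. entropy_constraint n \<mu>' \<gamma> j). ereal (\<integral>x. \<phi> x \<partial>\<nu>) - rel_entropy \<nu> (M n))"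
    \<comment> \<open>It suffices to treat real upper bounds \<open>p\<close> of the supremum, which
      is the form of \<open>strong_duality\<close> and spares a discussion of infinite
      values.\<close>
    proof (rule ereal_le_real)
      fix p assume "(SUP \<nu> \<in> (\<Inter>j\<in>{1..n}. entropy_constraint n \<mu>' \<gamma> j).
          ereal (\<integral>x. \<phi> x \<partial>\<nu>) - rel_entropy \<nu> (M n)) \<le> ereal p"
      then have "\<exists>m\<in>Parisi_seqs n. Parisi n \<mu>' \<gamma> m \<phi> \<le> p"
        by (intro strong_duality[OF n_ge_1 \<phi> B \<gamma>_pos \<gamma>_sum]) (auto simp: SUP_le_iff)
      then obtain m where "m \<in> Parisi_seqs n" "Parisi n \<mu>' \<gamma> m \<phi> \<le> p" by blast
      then show "(INF m \<in> Parisi_seqs n. ereal (Parisi n \<mu>' \<gamma> m \<phi>)) \<le> ereal p"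
        by (intro INF_lower2[of m]) auto
    qed
  qed
qed

end
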